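(* Let $\delta\geq 1$, $k\geq 0$ be integers, $h=k+1$, and let $n$ and $m$ be integers (with $n\geq 1$) with $d=2m/n\geq\delta$, $x=(d-\delta)/h$ and $$n\ \geq\ \max\left\{\frac{(2d+5h+1)^2}{4\delta},\ (2x+3)^2\right\}.$$ Then $$\min\{\mathrm{sp}(G,k):G\text{ a graph of order }n\text{ with }m\text{ edges and }\delta(G)=\delta\}\ =\ \max_{t\geq 1}\left\lceil f_t(n,m,\delta,k)\right\rceil ,$$ where the maximum is over integers $t\geq 1$.
   Context: Graphs are finite and simple; $\delta(G)$ is the minimum degree of $G$. For a graph $G$ and $B\subseteq V(G)$ the spread is $\mathrm{sp}(B)=\max_{u\in B}\deg_G(u)-\min_{v\in B}\deg_G(v)$, and $\mathrm{sp}(G,k)$ is the largest cardinality of a set $B\subseteq V(G)$ with $\mathrm{sp}(B)\leq k$. Further, $$f_t(n,m,\delta,k)=\frac{2\left(n(\delta+t(k+1))-2m\right)}{(k+1)\,t(t+1)}.$$ *)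

theory Defs
  imports Complex_Main
begin

definition simple_graph :: "'a set \<Rightarrow> 'a set set \<Rightarrow> bool" where
  "simple_graph V E \<longleftrightarrow> finite V \<and> (\<forall>e\<in>E. e \<subseteq> V \<and> card e = 2)"

definition degree :: "'a set set \<Rightarrow> 'a \<Rightarrow> nat" where
  "degree E v = card {e \<in> E. v \<in> e}"

definition min_degree :: "'a set \<Rightarrow> 'a set set \<Rightarrow> nat" where
  "min_degree V E = Min (degree E ` V)"

text \<open>The natural-number subtraction below does not truncate: for a nonempty finite
  \<open>B\<close> the maximum is at least the minimum. The spread of the empty set is
  meaningless and is never used.\<close>

definition spread :: "'a set set \<Rightarrow> 'a set \<Rightarrow> nat" where
  "spread E B = Max (degree E ` B) - Min (degree E ` B)"

definition sp :: "'a set \<Rightarrow> 'a set set \<Rightarrow> nat \<Rightarrow> nat" where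
  "sp V E k = Max {card B | B. B \<subseteq> V \<and> B \<noteq> {} \<and> spread E B \<le> k}"

definition f :: "nat \<Rightarrow> nat \<Rightarrow> nat \<Rightarrow> nat \<Rightarrow> nat \<Rightarrow> real" where
  "f t n m \<delta> k =
     2 * (real n * (real \<delta> + real t * (real k + 1)) - 2 * real m)
       / ((real k + 1) * real t * (real t + 1))"

text \<open>Every finite graph is isomorphic to one whose vertices are natural numbers, so
  taking vertex sets in \<^typ>\<open>nat\<close> loses no value of \<^const>\<open>sp\<close>.\<close>

definition sp_values :: "nat \<Rightarrow> nat \<Rightarrow> nat \<Rightarrow> nat \<Rightarrow> int set" where
  "sp_values n m \<delta> k =
     {int (sp V E k) | (V :: nat set) E.
        simple_graph V E \<and> card V = n \<and> card E = m \<and> min_degree V E = \<delta>}"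

end

(* The bound f_t <= sp(G,k) holds because each degree interval [delta + jh, delta + jh + k] contains
   at most sp(G,k) vertices, so the sorted degrees dominate delta + h*(i div s) with s = sp(G,k).
   Conversely, for s = max ceil(f_t) this dominated sequence has sum at most 2m. The missing amount
   is spread evenly over all vertices but one (which keeps degree delta), the larger degrees first.
   The hypothesis n >= (2x+3)^2 forces n/s <= 2x+1 and makes the increment at most 3h, so the maximum
   degree is at most 2d - delta + 4h; the other hypothesis on n then makes the sequence graphic. *)

theory Submission
  imports Defs
begin

section \<open>Degrees in simple graphs\<close>

text \<open>Two different values of t decide the construction. With \<open>T = n div s\<close>,
  every level of \<open>i div s\<close> below \<open>T\<close> is full, so \<open>f_T <= s\<close>,
  cleared of denominators, says exactly that the dominated sequence has sum at most 2m. A maximising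
  t has \<open>f_t > s - 1\<close>, so the missing amount is only what rounding \<open>f_t\<close>
  up to s can cost: less than h*t*(t+1)/2. The obstacle is therefore to keep the maximising t small.
  From \<open>f_t > s - 1\<close> comes (s-1)(t+1) < 2n; once n <= (s-1)(2x+3), this gives t+1 <
  2(2x+3), hence t(t+1) <= 4n and a missing amount below 2hn. The degree sequence is realised by a
  criterion that sees only its least and greatest terms, so the greatest degree is all that has to
  be controlled. Parity is no obstruction, since the total is prescribed to be 2m.\<close>

lemma simple_graph_finite_edges:
  assumes "simple_graph V E"
  shows "finite E"
  using assms finite_subset[of E "Pow V"] unfolding simple_graph_def by auto

lemma simple_graph_edge:
  assumes "simple_graph V E" "{u, v} \<in> E"
  shows "u \<noteq> v" "u \<in> V" "v \<in> V"
  using assms unfolding simple_graph_def by fastforce+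

lemma degree_eq_card_nbrs:
  assumes "simple_graph V E"
  shows "degree E v = card {u. {u, v} \<in> E}"
proof -
  have "bij_betw (\<lambda>u. {u, v}) {u. {u, v} \<in> E} {e \<in> E. v \<in> e}"
    unfolding bij_betw_def
  proof
    show "inj_on (\<lambda>u. {u, v}) {u. {u, v} \<in> E}"
      by (auto simp: inj_on_def doubleton_eq_iff)
    show "(\<lambda>u. {u, v}) ` {u. {u, v} \<in> E} = {e \<in> E. v \<in> e}"
    proof
      show "{e \<in> E. v \<in> e} \<subseteq> (\<lambda>u. {u, v}) ` {u. {u, v} \<in> E}"
      proof
        fix e assume e: "e \<in> {e \<in> E. v \<in> e}"
        then have "card e = 2" using assms unfolding simple_graph_def by auto
        then obtain u where "e = {u, v}" using e
          by (auto simp: card_2_iff)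
        then show "e \<in> (\<lambda>u. {u, v}) ` {u. {u, v} \<in> E}" using e by auto
      qed
    qed auto
  qed
  then show ?thesis unfolding degree_def by (metis bij_betw_same_card)
qed

lemma finite_nbrs:
  assumes "simple_graph V E"
  shows "finite {u. {u, v} \<in> E}"
proof (rule finite_subset)
  show "{u. {u, v} \<in> E} \<subseteq> V" using simple_graph_edge(2)[OF assms] by blast
qed (use assms simple_graph_def in blast)

lemma sum_degree:
  assumes "simple_graph V E"
  shows "(\<Sum>v\<in>V. degree E v) = 2 * card E"
proof -
  have "(\<Sum>v\<in>V. card {e \<in> E. v \<in> e}) = 2 * card E"
  proof (rule sum_multicount)
    show "\<forall>e\<in>E. card {v \<in> V. v \<in> e} = 2"
    proof
      fix e assume "e \<in> E"
      then have "{v \<in> V. v \<in> e} = e" "card e = 2"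
        using assms unfolding simple_graph_def by auto
      then show "card {v \<in> V. v \<in> e} = 2" by simp
    qed
  qed (use assms simple_graph_finite_edges in \<open>auto simp: simple_graph_def\<close>)
  then show ?thesis unfolding degree_def .
qed

lemma simple_graph_insert:
  "simple_graph V E \<Longrightarrow> u \<in> V \<Longrightarrow> v \<in> V \<Longrightarrow> u \<noteq> v \<Longrightarrow> simple_graph V (insert {u, v} E)"
  unfolding simple_graph_def by auto

lemma simple_graph_diff:
  "simple_graph V E \<Longrightarrow> simple_graph V (E - F)"
  unfolding simple_graph_def by auto

lemma degree_insert:
  assumes "finite E" "{u, v} \<notin> E"
  shows "degree (insert {u, v} E) w = degree E w + (if w = u \<or> w = v then 1 else 0)"
proof (cases "w = u \<or> w = v")
  case True
  then have "{e \<in> insert {u, v} E. w \<in> e} = insert {u, v} {e \<in> E. w \<in> e}" by auto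
  then show ?thesis using assms True unfolding degree_def by simp
next
  case False
  then have "{e \<in> insert {u, v} E. w \<in> e} = {e \<in> E. w \<in> e}" by auto
  then show ?thesis using False unfolding degree_def by simp
qed

lemma degree_remove:
  assumes "finite E" "{u, v} \<in> E"
  shows "degree (E - {{u, v}}) w = degree E w - (if w = u \<or> w = v then 1 else 0)"
proof (cases "w = u \<or> w = v")
  case True
  then have "{e \<in> E - {{u, v}}. w \<in> e} = {e \<in> E. w \<in> e} - {{u, v}}" by auto
  then show ?thesis using assms True unfolding degree_def by simp
next
  case False
  then have "{e \<in> E - {{u, v}}. w \<in> e} = {e \<in> E. w \<in> e}" by auto
  then show ?thesis using False unfolding degree_def by simp
qed

lemma degree_pos:
  assumes "finite E" "{u, v} \<in> E"
  shows "degree E u > 0" "degree E v > 0"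
  using assms unfolding degree_def by (auto simp: card_gt_0_iff)

text \<open>Supplies the vertex for edge exchanges: the edge \<open>ui\<close> can be traded for
  \<open>ur\<close>, moving one unit of degree from \<open>i\<close> to \<open>r\<close> and leaving
  \<open>u\<close> unchanged.\<close>

lemma exists_private_nbr:
  assumes G: "simple_graph V E" and "degree E r < degree E i"
  obtains u where "{u, i} \<in> E" "{u, r} \<notin> E" "u \<noteq> r" "u \<noteq> i" "u \<in> V" "i \<noteq> r"
proof -
  let ?N = "\<lambda>v. {u. {u, v} \<in> E}"
  have fin: "finite (?N v)" for v using finite_nbrs[OF G] .
  have lt: "card (?N r) < card (?N i)"
    using assms(2) degree_eq_card_nbrs[OF G] by simp
  have "\<exists>u. {u, i} \<in> E \<and> {u, r} \<notin> E \<and> u \<noteq> r"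
  proof (rule ccontr)
    assume no: "\<not> ?thesis"
    have "card (?N i) \<le> card (?N r)"
    proof (cases "{r, i} \<in> E")
      \<comment> \<open>Adjacent \<open>i\<close> and \<open>r\<close> occur in each other's
        neighbourhoods, and \<open>r\<close> is not an admissible \<open>u\<close>. Removing one
        vertex from each side restores the inclusion without changing the comparison of
        cardinalities.\<close>
      case True
      have ri: "r \<in> ?N i" "i \<in> ?N r" using True by (auto simp: insert_commute)
      have "?N i - {r} \<subseteq> ?N r - {i}" using no simple_graph_edge[OF G] by auto
      then have "card (?N i - {r}) \<le> card (?N r - {i})" using fin by (intro card_mono) auto
      then show ?thesis using ri fin
        by (metis (no_types, lifting) card_Suc_Diff1 Suc_le_mono)
    next
      case False
      then have "?N i \<subseteq> ?N r" using no by auto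
      then show ?thesis using fin by (intro card_mono) auto
    qed
    then show False using lt by simp
  qed
  then obtain u where u: "{u, i} \<in> E" "{u, r} \<notin> E" "u \<noteq> r" by blast
  then show thesis using that simple_graph_edge[OF G u(1)] assms(2) by auto
qed

section \<open>The Erdos--Gallai theorem\<close>

text \<open>The invariant of a step-by-step realization with critical index \<open>r\<close>:
  vertices before \<open>r\<close> are finished, \<open>r\<close> is being filled, and the later
  ones are independent, so they have neighbours only in \<open>{..r}\<close>. At
  \<open>r = n\<close> it is a full realization.\<close>

definition partial_realization :: "nat \<Rightarrow> (nat \<Rightarrow> nat) \<Rightarrow> nat \<Rightarrow> nat set set \<Rightarrow> bool" where
  "partial_realization n d r E \<longleftrightarrow>
     simple_graph {..<n} E \<and> (\<forall>i<n. degree E i \<le> d i) \<and> (\<forall>i<r. degree E i = d i) \<and>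
     (\<forall>i j. r < i \<longrightarrow> r < j \<longrightarrow> {i, j} \<notin> E)"

text \<open>Double counting of the edges between \<open>{..r}\<close> and the rest: each head vertex
  has \<open>r\<close> neighbours inside the clique, and each tail vertex has all its neighbours in
  the head. This is the equality case of the Erdos-Gallai inequality.\<close>

lemma partial_realization_split_degree_sum:
  assumes G: "simple_graph {..<n} E" and r: "r < n"
    and indep: "\<And>i j. r < i \<Longrightarrow> r < j \<Longrightarrow> {i, j} \<notin> E"
    and clique: "\<And>i j. i \<le> r \<Longrightarrow> j \<le> r \<Longrightarrow> i \<noteq> j \<Longrightarrow> {i, j} \<in> E"
  shows "(\<Sum>i\<le>r. degree E i) = (r + 1) * r + (\<Sum>k\<in>{r<..<n}. degree E k)"
proof -
  have low: "degree E i = r + card {k \<in> {r<..<n}. {k, i} \<in> E}" if i: "i \<le> r" for i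
  proof -
    have "{u. {u, i} \<in> E} = ({..r} - {i}) \<union> {k \<in> {r<..<n}. {k, i} \<in> E}"
    proof (intro set_eqI iffI)
      fix u assume "u \<in> {u. {u, i} \<in> E}"
      then show "u \<in> ({..r} - {i}) \<union> {k \<in> {r<..<n}. {k, i} \<in> E}"
        using simple_graph_edge[OF G, of u i] by auto
    next
      fix u assume "u \<in> ({..r} - {i}) \<union> {k \<in> {r<..<n}. {k, i} \<in> E}"
      then show "u \<in> {u. {u, i} \<in> E}" using clique[of u i] i by auto
    qed
    moreover have "card (({..r} - {i}) \<union> {k \<in> {r<..<n}. {k, i} \<in> E})
        = card ({..r} - {i}) + card {k \<in> {r<..<n}. {k, i} \<in> E}"
      by (intro card_Un_disjoint) auto
    ultimately show ?thesis using i degree_eq_card_nbrs[OF G] by simp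
  qed
  have high: "degree E k = card {i \<in> {..r}. {k, i} \<in> E}" if "r < k" for k
  proof -
    have "{u. {u, k} \<in> E} = {i \<in> {..r}. {k, i} \<in> E}"
      using indep[OF _ that] by (auto simp: insert_commute not_less[symmetric])
    then show ?thesis using degree_eq_card_nbrs[OF G] by simp
  qed
  have "(\<Sum>i\<le>r. degree E i) = (r + 1) * r + (\<Sum>i\<le>r. card {k \<in> {r<..<n}. {k, i} \<in> E})"
    using low by (simp add: sum.distrib)
  also have "(\<Sum>i\<le>r. card {k \<in> {r<..<n}. {k, i} \<in> E})
      = (\<Sum>k\<in>{r<..<n}. card {i \<in> {..r}. {k, i} \<in> E})"
    by (rule sum_multicount_gen) auto
  also have "\<dots> = (\<Sum>k\<in>{r<..<n}. degree E k)" using high by simp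
  finally show ?thesis .
qed

text \<open>The exchange steps are those of Tripathi, Venugopalan and West.\<close>

lemma partial_realization_improve:
  assumes P: "partial_realization n d r E" and r: "r < n" and lt: "degree E r < d r"
    and anti: "\<And>i j. i \<le> j \<Longrightarrow> j < n \<Longrightarrow> d j \<le> d i"
    and even: "even (\<Sum>i<n. d i)"
    and EG: "(\<Sum>i\<le>r. d i) \<le> (r + 1) * r + (\<Sum>k\<in>{r<..<n}. min (r + 1) (d k))"
  shows "\<exists>E'. partial_realization n d r E' \<and> degree E r < degree E' r"
proof (rule ccontr)
  assume "\<not> ?thesis"
  then have no: "\<not> partial_realization n d r E'" if "degree E r < degree E' r" for E'
    using that by blast
  have G: "simple_graph {..<n} E" and le: "\<And>i. i < n \<Longrightarrow> degree E i \<le> d i"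
    and eq: "\<And>i. i < r \<Longrightarrow> degree E i = d i"
    and indep: "\<And>i j. r < i \<Longrightarrow> r < j \<Longrightarrow> {i, j} \<notin> E"
    using P unfolding partial_realization_def by auto
  have fin: "finite E" using simple_graph_finite_edges[OF G] .
  note edge = simple_graph_edge[OF G]
  \<comment> \<open>From here on, every exchange that would raise the degree of \<open>r\<close> is
    impossible, and each impossibility forces structure on \<open>E\<close>. Together they give
    equality in Erdos-Gallai, which the deficient \<open>r\<close> contradicts.\<close>
  have full: "{r, i} \<in> E" if i: "i < n" "i \<noteq> r" "degree E i < d i" for i
  proof (rule ccontr)
    assume ni: "{r, i} \<notin> E"
    have "r < i" using eq[of i] i by (metis linorder_neqE_nat nat_less_le)
    let ?F = "insert {r, i} E"
    have "degree E r < degree ?F r" using degree_insert[OF fin ni] by simp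
    moreover have "partial_realization n d r ?F"
      unfolding partial_realization_def
      using simple_graph_insert[OF G] r i le eq indep lt \<open>r < i\<close> degree_insert[OF fin ni]
      by (auto simp: doubleton_eq_iff Suc_leI)
    ultimately show False using no by blast
  qed
  have spare: "\<exists>u. {u, i} \<in> E \<and> {u, r} \<notin> E \<and> u \<noteq> r \<and> u \<noteq> i \<and> u < n" if "i < r" for i
  proof -
    have "degree E r < degree E i" using lt eq[OF that] anti[of i r] that r by simp
    then show ?thesis using exists_private_nbr[OF G] by (metis lessThan_iff)
  qed
  \<comment> \<open>Replacing \<open>ui\<close> by \<open>ur\<close> and \<open>ir\<close> keeps the
    degrees of \<open>u\<close> and \<open>i\<close> and raises that of \<open>r\<close> by
    2.\<close>
  have adj: "{i, r} \<in> E" if i: "i < r" for i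
  proof (rule ccontr)
    assume ni: "{i, r} \<notin> E"
    obtain u where u: "{u, i} \<in> E" "{u, r} \<notin> E" "u \<noteq> r" "u \<noteq> i" "u < n"
      using spare[OF i] by blast
    let ?E1 = "E - {{u, i}}"
    let ?E2 = "insert {i, r} (insert {u, r} ?E1)"
    have G2: "simple_graph {..<n} ?E2"
      by (intro simple_graph_insert simple_graph_diff G) (use i r u in auto)
    have d2: "degree ?E2 w = degree E w - (if w = u \<or> w = i then 1 else 0)
        + (if w = u \<or> w = r then 1 else 0) + (if w = i \<or> w = r then 1 else 0)" for w
    proof -
      have "degree ?E2 w = degree (insert {u, r} ?E1) w + (if w = i \<or> w = r then 1 else 0)"
        by (rule degree_insert) (use fin ni u in \<open>auto simp: doubleton_eq_iff\<close>)
      also have "degree (insert {u, r} ?E1) w = degree ?E1 w + (if w = u \<or> w = r then 1 else 0)"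
        by (rule degree_insert) (use fin u in auto)
      finally show ?thesis using degree_remove[OF fin u(1)] by simp
    qed
    have pos: "degree E u > 0" "degree E i > 0" using degree_pos[OF fin u(1)] by auto
    show False
    proof (cases "degree E r + 2 \<le> d r")
      case True
      have "degree E r < degree ?E2 r" using d2[of r] u i by simp
      moreover have "partial_realization n d r ?E2"
        unfolding partial_realization_def
        using G2 d2 le eq indep True pos u i by (auto simp: doubleton_eq_iff)
      ultimately show False using no by blast
    next
      case False
      \<comment> \<open>Here \<open>r\<close> lacks exactly one unit, so a gain of 2 is too much. As
        both degree sums are even, a second vertex \<open>k\<close> is deficient; it is adjacent to
        \<open>r\<close> by \<open>full\<close>, and deleting \<open>rk\<close> leaves
        \<open>r\<close> with a net gain of 1.\<close>
      have "\<exists>k<n. k \<noteq> r \<and> degree E k < d k"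
      proof (rule ccontr)
        assume "\<not> ?thesis"
        then have "\<forall>k\<in>{..<n} - {r}. degree E k = d k" using le by (auto simp: le_less)
        then have s: "sum (degree E) ({..<n} - {r}) = sum d ({..<n} - {r})" by simp
        have "sum (degree E) {..<n} = degree E r + sum (degree E) ({..<n} - {r})"
          "sum d {..<n} = d r + sum d ({..<n} - {r})"
          using r by (auto simp: sum.remove)
        moreover have "even (sum (degree E) {..<n})" using sum_degree[OF G] by simp
        moreover have "d r = degree E r + 1" using False lt by simp
        ultimately show False using even s by simp
      qed
      then obtain k where k: "k < n" "k \<noteq> r" "degree E k < d k" by blast
      have kr: "r < k" using eq[of k] k by (metis linorder_neqE_nat nat_less_le)
      have rk: "{r, k} \<in> E" using full[OF k] .
      have ku: "k \<noteq> u" using rk u by (auto simp: insert_commute)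
      let ?E3 = "?E2 - {{r, k}}"
      have d3: "degree ?E3 w = degree ?E2 w - (if w = r \<or> w = k then 1 else 0)" for w
        by (rule degree_remove) (use fin rk kr i u in \<open>auto simp: doubleton_eq_iff\<close>)
      have "degree E r < degree ?E3 r" using d3[of r] d2[of r] u i by simp
      moreover have "partial_realization n d r ?E3"
        unfolding partial_realization_def
      proof (intro conjI allI impI)
        show "simple_graph {..<n} ?E3" by (intro simple_graph_diff G2)
        show "degree ?E3 j \<le> d j" if "j < n" for j
          using le[OF that] lt pos u i kr ku unfolding d3 d2 by auto
        show "degree ?E3 j = d j" if "j < r" for j
          using eq[OF that] lt pos u i kr ku that unfolding d3 d2 by auto
        show "{a, b} \<notin> ?E3" if "r < a" "r < b" for a b
          using indep[OF that] that i by (auto simp: doubleton_eq_iff)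
      qed
      ultimately show False using no by blast
    qed
  qed
  \<comment> \<open>Otherwise \<open>k\<close> is deficient and misses some \<open>i < r\<close>.
    Replacing \<open>ui\<close> by \<open>ur\<close> and \<open>ik\<close> then raises both
    \<open>r\<close> and \<open>k\<close> by 1 and changes no other degree.\<close>
  have saturated: "degree E k = min (r + 1) (d k)" if k: "r < k" "k < n" for k
  proof (rule ccontr)
    assume ne: "degree E k \<noteq> min (r + 1) (d k)"
    have nb: "{u. {u, k} \<in> E} \<subseteq> {..r}" using indep k(1) by (auto simp: not_less[symmetric])
    then have "degree E k \<le> r + 1"
      using card_mono[OF _ nb] degree_eq_card_nbrs[OF G, of k] by simp
    then have dk: "degree E k < r + 1" "degree E k < d k" using ne le[OF k(2)] by auto
    have rk: "{r, k} \<in> E" using full k dk by simp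
    have "\<exists>i<r. {i, k} \<notin> E"
    proof (rule ccontr)
      assume "\<not> ?thesis"
      then have "{..r} \<subseteq> {u. {u, k} \<in> E}" using rk by (auto simp: le_less)
      then have "card {..r} \<le> degree E k"
        unfolding degree_eq_card_nbrs[OF G] by (intro card_mono finite_nbrs[OF G])
      then show False using dk by simp
    qed
    then obtain i where i: "i < r" "{i, k} \<notin> E" by blast
    obtain u where u: "{u, i} \<in> E" "{u, r} \<notin> E" "u \<noteq> r" "u \<noteq> i" "u < n"
      using spare[OF i(1)] by blast
    have uk: "u \<noteq> k" using u rk by (auto simp: insert_commute)
    let ?E1 = "E - {{u, i}}"
    let ?E2 = "insert {i, k} (insert {u, r} ?E1)"
    have G2: "simple_graph {..<n} ?E2"
      by (intro simple_graph_insert simple_graph_diff G) (use i k r u in auto)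
    have d2: "degree ?E2 w = degree E w - (if w = u \<or> w = i then 1 else 0)
        + (if w = u \<or> w = r then 1 else 0) + (if w = i \<or> w = k then 1 else 0)" for w
    proof -
      have "degree ?E2 w = degree (insert {u, r} ?E1) w + (if w = i \<or> w = k then 1 else 0)"
        by (rule degree_insert) (use fin i k u in \<open>auto simp: doubleton_eq_iff\<close>)
      also have "degree (insert {u, r} ?E1) w = degree ?E1 w + (if w = u \<or> w = r then 1 else 0)"
        by (rule degree_insert) (use fin u in auto)
      finally show ?thesis using degree_remove[OF fin u(1)] by simp
    qed
    have pos: "degree E u > 0" "degree E i > 0" using degree_pos[OF fin u(1)] by auto
    have "degree E r < degree ?E2 r" using d2[of r] u i by simp
    moreover have "partial_realization n d r ?E2"
      unfolding partial_realization_def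
    proof (intro conjI allI impI)
      show "simple_graph {..<n} ?E2" by (rule G2)
      show "degree ?E2 j \<le> d j" if "j < n" for j
        using le[OF that] lt pos u i k dk uk unfolding d2 by auto
      show "degree ?E2 j = d j" if "j < r" for j
        using eq[OF that] lt pos u i k uk that unfolding d2 by auto
      show "{a, b} \<notin> ?E2" if "r < a" "r < b" for a b
        using indep[OF that] that i by (auto simp: doubleton_eq_iff)
    qed
    ultimately show False using no by blast
  qed
  \<comment> \<open>Replacing \<open>ui\<close> and \<open>wj\<close> by \<open>ij\<close> and
    \<open>ur\<close> gives \<open>r\<close> one unit at the expense of \<open>w\<close>. This is
    allowed because \<open>adj\<close> places \<open>w\<close> after \<open>r\<close>, where degrees
    are only bounded above; \<open>u = w\<close> is possible.\<close>
  have clique: "{i, j} \<in> E" if ij: "i < j" "j < r" for i j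
  proof (rule ccontr)
    assume nij: "{i, j} \<notin> E"
    obtain u where u: "{u, i} \<in> E" "{u, r} \<notin> E" "u \<noteq> r" "u \<noteq> i" "u < n"
      using spare[of i] ij by auto
    obtain w where w: "{w, j} \<in> E" "{w, r} \<notin> E" "w \<noteq> r" "w \<noteq> j" "w < n"
      using spare[of j] ij by auto
    have big: "r < u" "r < w" using adj u w by (metis linorder_neqE_nat)+
    let ?E1 = "E - {{u, i}}"
    let ?E2 = "?E1 - {{w, j}}"
    let ?E3 = "insert {i, j} (insert {u, r} ?E2)"
    have G3: "simple_graph {..<n} ?E3"
      by (intro simple_graph_insert simple_graph_diff G) (use ij r u in auto)
    have d3: "degree ?E3 v = degree E v - (if v = u \<or> v = i then 1 else 0)
        - (if v = w \<or> v = j then 1 else 0)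
        + (if v = u \<or> v = r then 1 else 0) + (if v = i \<or> v = j then 1 else 0)" for v
    proof -
      have "degree ?E3 v = degree (insert {u, r} ?E2) v + (if v = i \<or> v = j then 1 else 0)"
        by (rule degree_insert) (use fin ij u nij in \<open>auto simp: doubleton_eq_iff\<close>)
      also have "degree (insert {u, r} ?E2) v = degree ?E2 v + (if v = u \<or> v = r then 1 else 0)"
        by (rule degree_insert) (use fin u in auto)
      also have "degree ?E2 v = degree ?E1 v - (if v = w \<or> v = j then 1 else 0)"
        by (rule degree_remove) (use fin w ij big in \<open>auto simp: doubleton_eq_iff\<close>)
      finally show ?thesis using degree_remove[OF fin u(1)] by simp
    qed
    have pos: "degree E u > 0" "degree E i > 0" "degree E w > 0" "degree E j > 0"
      using degree_pos[OF fin u(1)] degree_pos[OF fin w(1)] by auto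
    have "degree E r < degree ?E3 r" using d3[of r] u w ij by simp
    moreover have "partial_realization n d r ?E3"
      unfolding partial_realization_def
    proof (intro conjI allI impI)
      show "simple_graph {..<n} ?E3" by (rule G3)
      show "degree ?E3 v \<le> d v" if "v < n" for v
        using le[OF that] lt pos ij big unfolding d3 by auto
      show "degree ?E3 v = d v" if "v < r" for v
        using eq[OF that] lt pos ij big that unfolding d3 by auto
      show "{a, b} \<notin> ?E3" if "r < a" "r < b" for a b
        using indep[OF that] that ij by (auto simp: doubleton_eq_iff)
    qed
    ultimately show False using no by blast
  qed
  have clique': "{i, j} \<in> E" if "i \<le> r" "j \<le> r" "i \<noteq> j" for i j
    using that clique adj by (metis insert_commute le_neq_implies_less linorder_neqE_nat)
  have "(\<Sum>i\<le>r. degree E i) < (\<Sum>i\<le>r. d i)"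
    by (rule sum_strict_mono_ex1) (use le lt r in auto)
  also have "\<dots> \<le> (r + 1) * r + (\<Sum>k\<in>{r<..<n}. degree E k)"
    using EG saturated by simp
  finally show False
    using partial_realization_split_degree_sum[OF G r indep clique'] by simp
qed

text \<open>Starting from the empty graph, a partial realization at \<open>r\<close> with the
  largest possible degree of \<open>r\<close> cannot be improved, so it meets \<open>d r\<close>
  exactly and is also one for \<open>Suc r\<close>.\<close>

lemma erdos_gallai_sufficient:
  assumes anti: "\<And>i j. i \<le> j \<Longrightarrow> j < n \<Longrightarrow> d j \<le> d i"
    and even: "even (\<Sum>i<n. d i)"
    and EG: "\<And>r. r < n \<Longrightarrow>
      (\<Sum>i\<le>r. d i) \<le> (r + 1) * r + (\<Sum>k\<in>{r<..<n}. min (r + 1) (d k))"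
  shows "\<exists>E. simple_graph {..<n} E \<and> (\<forall>i<n. degree E i = d i)"
proof -
  have "\<exists>E. partial_realization n d r E" if "r \<le> n" for r
    using that
  proof (induction r)
    case 0
    show ?case
      by (rule exI[of _ "{}"]) (simp add: partial_realization_def simple_graph_def degree_def)
  next
    case (Suc r)
    then obtain E0 where "partial_realization n d r E0" by auto
    moreover have "\<forall>E. partial_realization n d r E \<longrightarrow> degree E r < Suc (d r)"
      using Suc.prems unfolding partial_realization_def by (simp add: less_Suc_eq_le)
    ultimately obtain E where E: "partial_realization n d r E"
      "\<And>F. partial_realization n d r F \<Longrightarrow> degree F r \<le> degree E r"
      using ex_has_greatest_nat[of "partial_realization n d r" E0 "\<lambda>E. degree E r" "Suc (d r)"]
      by blast
    have "\<not> degree E r < d r"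
    proof
      assume "degree E r < d r"
      then obtain F where "partial_realization n d r F" "degree E r < degree F r"
        using partial_realization_improve[OF E(1) _ _ anti even EG] Suc.prems by auto
      then show False using E(2) by (meson leD)
    qed
    then have "degree E r = d r" using E(1) Suc.prems
      unfolding partial_realization_def by (simp add: le_antisym)
    then have "partial_realization n d (Suc r) E" using E(1)
      unfolding partial_realization_def by (auto simp: less_Suc_eq)
    then show ?case ..
  qed
  then obtain E where "partial_realization n d n E" by blast
  then show ?thesis unfolding partial_realization_def by blast
qed

text \<open>The criterion of Zverovich and Zverovich.\<close>

lemma graphic_if_bounded:
  assumes anti: "\<And>i j. i \<le> j \<Longrightarrow> j < n \<Longrightarrow> d j \<le> d i"
    and even: "even (\<Sum>i<n. d i)"
    and b: "\<And>i. i < n \<Longrightarrow> b \<le> d i" "b \<ge> 1"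
    and a: "\<And>i. i < n \<Longrightarrow> d i \<le> a"
    and n: "(a + b + 1)\<^sup>2 \<le> 4 * b * n"
  shows "\<exists>E. simple_graph {..<n} E \<and> (\<forall>i<n. degree E i = d i)"
proof (rule erdos_gallai_sufficient[OF anti even])
  fix r assume r: "r < n"
  have "(\<Sum>i\<le>r. d i) \<le> (\<Sum>i\<le>r. a)" by (rule sum_mono) (use a r in auto)
  then have 1: "(\<Sum>i\<le>r. d i) \<le> (r + 1) * a" by simp
  have "(\<Sum>k\<in>{r<..<n}. min (r + 1) b) \<le> (\<Sum>k\<in>{r<..<n}. min (r + 1) (d k))"
    by (rule sum_mono) (use b in \<open>auto simp: min_def intro: order_trans\<close>)
  then have 2: "(n - Suc r) * min (r + 1) b \<le> (\<Sum>k\<in>{r<..<n}. min (r + 1) (d k))" by simp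
  \<comment> \<open>The Erdos-Gallai inequality in its worst case, with head degrees replaced by
    \<open>a\<close> and tail degrees by \<open>b\<close>.\<close>
  have "(r + 1) * a \<le> (r + 1) * r + (n - Suc r) * min (r + 1) b"
  proof (cases "r + 1 \<le> b")
    case True
    \<comment> \<open>For \<open>r + 1 <= b\<close> the factor \<open>r + 1\<close> cancels and only
      \<open>a + 1 <= n\<close> remains, which follows from 4b(a+1) <= (a+b+1)^2.\<close>
    have "0 \<le> (int a + 1 - int b)\<^sup>2" by simp
    then have "4 * int b * (int a + 1) \<le> (int a + int b + 1)\<^sup>2"
      by (simp add: power2_eq_square algebra_simps)
    also have "\<dots> \<le> 4 * int b * int n" using n
      by (metis (mono_tags, lifting) of_nat_1 of_nat_add of_nat_le_iff of_nat_mult of_nat_numeral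
          of_nat_power)
    finally have "a + 1 \<le> n" using b(2) by simp
    then have "(r + 1) * a \<le> (r + 1) * (r + (n - Suc r))" using r by (intro mult_left_mono) auto
    then show ?thesis using True by (simp add: algebra_simps)
  next
    case False
    \<comment> \<open>With p = r+1 the goal is p(a+b+1-p) <= bn. The left side, quadratic in p, is
      at most (a+b+1)^2/4.\<close>
    have "0 \<le> (int a + int b + 1 - 2 * (int r + 1))\<^sup>2" by simp
    then have "4 * ((int r + 1) * (int a + int b + 1 - (int r + 1))) \<le> (int a + int b + 1)\<^sup>2"
      by (simp add: power2_eq_square algebra_simps)
    also have "\<dots> \<le> 4 * int b * int n" using n
      by (metis (mono_tags, lifting) of_nat_1 of_nat_add of_nat_le_iff of_nat_mult of_nat_numeral
          of_nat_power)
    finally have "(int r + 1) * (int a + int b + 1 - (int r + 1)) \<le> int b * int n" by simp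
    moreover obtain q where q: "n = Suc (r + q)" using r less_imp_Suc_add by blast
    ultimately have "int ((r + 1) * a) \<le> int ((r + 1) * r + q * b)"
      by (simp add: algebra_simps)
    then have "(r + 1) * a \<le> (r + 1) * r + q * b" by (simp only: of_nat_le_iff)
    then show ?thesis using False q by simp
  qed
  then show "(\<Sum>i\<le>r. d i) \<le> (r + 1) * r + (\<Sum>k\<in>{r<..<n}. min (r + 1) (d k))"
    using 1 2 by linarith
qed

section \<open>Functions with small level sets\<close>

text \<open>A vertex of level j < t falls short of t by t - j, and each level holds at most
  \<open>s\<close> vertices, so the total shortfall is at most s*t*(t+1)/2. Everything is doubled to
  avoid division.\<close>

lemma sum_ge_if_levels_small:
  fixes g :: "'a \<Rightarrow> nat"
  assumes fin: "finite V" and lev: "\<And>j. card {v \<in> V. g v = j} \<le> s"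
  shows "2 * t * card V \<le> 2 * (\<Sum>v\<in>V. g v) + s * t * (t + 1)"
proof -
  have tri: "2 * (\<Sum>j<t. t - j) = t * (t + 1)"
  proof (induction t)
    case (Suc t)
    have "(\<Sum>j<Suc t. Suc t - j) = Suc t + (\<Sum>j<t. t - j)"
      by (simp add: sum.lessThan_Suc_shift del: sum.lessThan_Suc)
    then show ?case using Suc by (simp add: algebra_simps)
  qed simp
  have "t \<le> g v + (\<Sum>j<t. if g v = j then t - j else 0)" for v
    by simp
  then have "(\<Sum>v\<in>V. t) \<le> (\<Sum>v\<in>V. g v + (\<Sum>j<t. if g v = j then t - j else 0))"
    by (rule sum_mono)
  also have "\<dots> = (\<Sum>v\<in>V. g v) + (\<Sum>j<t. \<Sum>v\<in>V. if g v = j then t - j else 0)"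
    by (simp only: sum.distrib sum.swap[of _ "{..<t}"])
  also have "(\<Sum>j<t. \<Sum>v\<in>V. if g v = j then t - j else 0)
      = (\<Sum>j<t. card {v \<in> V. g v = j} * (t - j))"
    using fin by (simp add: sum.If_cases Int_def)
  also have "\<dots> \<le> (\<Sum>j<t. s * (t - j))" by (intro sum_mono mult_right_mono lev) auto
  finally have "card V * t \<le> (\<Sum>v\<in>V. g v) + s * (\<Sum>j<t. t - j)"
    by (simp add: sum_distrib_left)
  then have "2 * (card V * t) \<le> 2 * ((\<Sum>v\<in>V. g v) + s * (\<Sum>j<t. t - j))" by (rule mult_left_mono) simp
  also have "\<dots> = 2 * (\<Sum>v\<in>V. g v) + s * (2 * (\<Sum>j<t. t - j))" by (simp add: algebra_simps)
  finally show ?thesis unfolding tri by (simp add: algebra_simps)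
qed

text \<open>The equality case of the preceding bound at t = \<open>n div s\<close>: the levels below
  t have exactly \<open>s\<close> elements and all remaining indices have value t.\<close>

lemma sum_div_eq:
  fixes s n :: nat
  assumes "s > 0"
  shows "2 * (\<Sum>i<n. i div s) + s * (n div s) * (n div s + 1) = 2 * (n div s) * n"
proof (induction n)
  case (Suc n)
  show ?case
  proof (cases "Suc n mod s = 0")
    case True
    define q where "q = n div s"
    from True have T: "Suc n div s = Suc q" by (simp add: div_Suc q_def)
    have "s * (Suc n div s) = Suc n" using True by auto
    then have n: "Suc n = s * Suc q" unfolding T by simp
    have "2 * (\<Sum>i<Suc n. i div s) + s * Suc q * (Suc q + 1)
        = (2 * (\<Sum>i<n. i div s) + s * q * (q + 1)) + 2 * q + 2 * (s * Suc q)"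
      by (simp add: q_def algebra_simps)
    also have "\<dots> = 2 * q * n + 2 * q + 2 * Suc n"
      using Suc unfolding q_def[symmetric] n by simp
    also have "\<dots> = 2 * Suc q * Suc n" by simp
    finally show ?thesis unfolding T .
  next
    case False
    then have "Suc n div s = n div s" by (simp add: div_Suc)
    then show ?thesis using Suc by (simp add: algebra_simps)
  qed
qed simp

lemma card_div_level_le:
  fixes s n j :: nat
  assumes "s > 0"
  shows "card {i \<in> {..<n}. i div s = j} \<le> s"
proof -
  have "{i \<in> {..<n}. i div s = j} \<subseteq> {j * s..<j * s + s}"
    using assms by (auto simp: dividend_less_div_times) (metis add.commute dividend_less_div_times)
  from card_mono[OF _ this] show ?thesis by simp
qed

section \<open>Sets of small spread\<close>

lemma spread_le_iff:
  assumes "finite B" "B \<noteq> {}"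
  shows "spread E B \<le> k \<longleftrightarrow> (\<forall>u\<in>B. \<forall>v\<in>B. degree E u \<le> degree E v + k)"
proof
  assume k: "spread E B \<le> k"
  show "\<forall>u\<in>B. \<forall>v\<in>B. degree E u \<le> degree E v + k"
  proof (intro ballI)
    fix u v assume "u \<in> B" "v \<in> B"
    then have "degree E u \<le> Max (degree E ` B)" "Min (degree E ` B) \<le> degree E v"
      using assms(1) by auto
    then show "degree E u \<le> degree E v + k" using k unfolding spread_def by linarith
  qed
next
  assume k: "\<forall>u\<in>B. \<forall>v\<in>B. degree E u \<le> degree E v + k"
  have "Max (degree E ` B) \<in> degree E ` B" "Min (degree E ` B) \<in> degree E ` B"
    using assms by auto
  then obtain u v where "u \<in> B" "v \<in> B"
    "Max (degree E ` B) = degree E u" "Min (degree E ` B) = degree E v"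
    by blast
  then show "spread E B \<le> k" using k unfolding spread_def by (simp add: le_diff_conv add.commute)
qed

lemma sp_set_finite:
  assumes "finite V"
  shows "finite {card B | B. B \<subseteq> V \<and> B \<noteq> {} \<and> spread E B \<le> k}"
proof (rule finite_subset)
  show "{card B | B. B \<subseteq> V \<and> B \<noteq> {} \<and> spread E B \<le> k} \<subseteq> card ` Pow V" by auto
qed (use assms in auto)

lemma sp_set_nonempty:
  assumes "v \<in> V"
  shows "{card B | B. B \<subseteq> V \<and> B \<noteq> {} \<and> spread E B \<le> k} \<noteq> {}"
proof -
  have "spread E {v} \<le> k" unfolding spread_def by simp
  then show ?thesis using assms by blast
qed

lemma card_le_sp:
  assumes "finite V" "B \<subseteq> V" "\<And>u v. u \<in> B \<Longrightarrow> v \<in> B \<Longrightarrow> degree E u \<le> degree E v + k"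
  shows "card B \<le> sp V E k"
proof (cases "B = {}")
  case False
  have "spread E B \<le> k"
    using spread_le_iff[of B E k] assms False finite_subset by blast
  then show ?thesis unfolding sp_def
    using assms False by (intro Max_ge sp_set_finite) auto
qed simp

lemma sp_le:
  assumes "finite V" "V \<noteq> {}"
    and "\<And>B. B \<subseteq> V \<Longrightarrow> B \<noteq> {} \<Longrightarrow> (\<And>u v. u \<in> B \<Longrightarrow> v \<in> B \<Longrightarrow> degree E u \<le> degree E v + k)
      \<Longrightarrow> card B \<le> s"
  shows "sp V E k \<le> s"
proof -
  have "c \<le> s" if "c \<in> {card B | B. B \<subseteq> V \<and> B \<noteq> {} \<and> spread E B \<le> k}" for c
  proof -
    obtain B where B: "c = card B" "B \<subseteq> V" "B \<noteq> {}" "spread E B \<le> k" using \<open>c \<in> _\<close> by blast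
    then have "finite B" using assms(1) finite_subset by blast
    then have "\<forall>u\<in>B. \<forall>v\<in>B. degree E u \<le> degree E v + k" using B spread_le_iff by metis
    then show ?thesis using assms(3)[of B] B by blast
  qed
  moreover obtain v where "v \<in> V" using assms(2) by blast
  ultimately show ?thesis unfolding sp_def
    using Max.boundedI[OF sp_set_finite[OF assms(1)] sp_set_nonempty] by simp
qed

text \<open>The level bound is applied to the index \<open>g v\<close> of the block of
  \<open>k + 1\<close> consecutive degrees, counted from \<delta>, that contains the degree of
  \<open>v\<close>; multiplying by \<open>k + 1\<close> turns it into a bound on 2m.\<close>

lemma f_le_sp:
  assumes G: "simple_graph V E" and V: "card V = n" "n \<ge> 1" and m: "card E = m"
    and \<delta>: "min_degree V E = \<delta>" and t: "t \<ge> 1"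
  shows "f t n m \<delta> k \<le> real (sp V E k)"
proof -
  have fin: "finite V" using G unfolding simple_graph_def by simp
  define g where "g v = (degree E v - \<delta>) div (k + 1)" for v
  define s where "s = sp V E k"
  have ge: "\<delta> \<le> degree E v" if "v \<in> V" for v
    using \<delta> fin that unfolding min_degree_def by auto
  have g: "\<delta> + (k + 1) * g v \<le> degree E v" "degree E v \<le> \<delta> + (k + 1) * g v + k"
    if "v \<in> V" for v
  proof -
    have "degree E v - \<delta> = (k + 1) * g v + (degree E v - \<delta>) mod (k + 1)"
      unfolding g_def by (metis mult_div_mod_eq)
    moreover have "(degree E v - \<delta>) mod (k + 1) \<le> k"
      by (metis add.commute less_Suc_eq_le mod_less_divisor plus_1_eq_Suc zero_less_Suc)
    ultimately show "\<delta> + (k + 1) * g v \<le> degree E v" "degree E v \<le> \<delta> + (k + 1) * g v + k"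
      using ge[OF that] by linarith+
  qed
  have lev: "card {v \<in> V. g v = j} \<le> s" for j unfolding s_def
  proof (rule card_le_sp[OF fin])
    fix u v assume "u \<in> {v \<in> V. g v = j}" "v \<in> {v \<in> V. g v = j}"
    then show "degree E u \<le> degree E v + k" using g(1)[of v] g(2)[of u] by simp
  qed auto
  have "(\<Sum>v\<in>V. \<delta> + (k + 1) * g v) \<le> (\<Sum>v\<in>V. degree E v)" by (rule sum_mono) (use g in auto)
  then have "n * \<delta> + (k + 1) * (\<Sum>v\<in>V. g v) \<le> 2 * m"
    using sum_degree[OF G] m V(1) by (simp add: sum.distrib sum_distrib_left)
  then have "real (n * \<delta> + (k + 1) * sum g V) \<le> real (2 * m)" by (simp only: of_nat_le_iff)
  then have 1: "real n * real \<delta> + (real k + 1) * real (sum g V) \<le> 2 * real m"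
    by (simp add: algebra_simps del: of_nat_sum)
  have "2 * t * n \<le> 2 * sum g V + s * t * (t + 1)"
    using sum_ge_if_levels_small[OF fin lev, of t] V(1) by simp
  then have "real (2 * t * n) \<le> real (2 * sum g V + s * t * (t + 1))" by (simp only: of_nat_le_iff)
  then have "2 * real t * real n \<le> 2 * real (sum g V) + real s * real t * (real t + 1)"
    by (simp add: algebra_simps del: of_nat_sum)
  then have "(real k + 1) * (2 * real t * real n)
      \<le> (real k + 1) * (2 * real (sum g V) + real s * real t * (real t + 1))"
    by (rule mult_left_mono) simp
  then have "2 * (real n * (real \<delta> + real t * (real k + 1)) - 2 * real m)
      \<le> real s * ((real k + 1) * real t * (real t + 1))"
    using 1 by (simp add: algebra_simps del: of_nat_sum)
  then show ?thesis unfolding f_def s_def using t by (simp add: divide_le_eq)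
qed

section \<open>The extremal graph\<close>

lemma exists_spread_sequence:
  fixes \<delta> h s n M :: nat
  defines "D \<equiv> M - (n * \<delta> + h * (\<Sum>i<n. i div s))"
  assumes s: "s > 0" and n: "n \<ge> 2" and M: "n * \<delta> + h * (\<Sum>i<n. i div s) \<le> M"
  obtains g :: "nat \<Rightarrow> nat" where "g 0 = \<delta>" "mono g" "\<And>i. g i + h \<le> g (i + s)"
    "(\<Sum>i<n. g i) = M" "g (n - 1) \<le> \<delta> + h * ((n - 1) div s) + D div (n - 1) + 1"
proof -
  define e r where "e = D div (n - 1)" and "r = D mod (n - 1)"
  \<comment> \<open>Both corrections vanish at 0 (for \<open>q\<close> because
    \<open>r < n - 1\<close>), so the degree \<delta> is attained. Both are monotone, so the gap
    \<open>h\<close> between positions \<open>i\<close> and \<open>i + s\<close> survives.\<close>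
  define p q :: "nat \<Rightarrow> nat" where "p i = (if i = 0 then 0 else e)"
    and "q i = (if n - r \<le> i then 1 else 0)" for i
  define g where "g i = \<delta> + h * (i div s) + p i + q i" for i
  have r: "r < n - 1" unfolding r_def using n by simp
  have mono: "mono p" "mono q" unfolding p_def q_def by (auto intro!: monoI)
  have "mono g"
    unfolding g_def by (auto intro!: monoI add_mono mult_left_mono div_le_mono monoD[OF mono(1)] monoD[OF mono(2)])
  moreover have "g i + h \<le> g (i + s)" for i
    using monoD[OF mono(1), of i "i + s"] monoD[OF mono(2), of i "i + s"] s
    unfolding g_def by simp
  moreover have "g 0 = \<delta>" unfolding g_def p_def q_def using r by simp
  moreover have "(\<Sum>i<n. g i) = M"
  proof -
    have "(\<Sum>i<n. p i) = (n - 1) * e"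
      using n by (cases n) (auto simp: p_def sum.lessThan_Suc_shift simp del: sum.lessThan_Suc)
    moreover have "(\<Sum>i<n. q i) = r"
    proof -
      have "{i \<in> {..<n}. n - r \<le> i} = {n - r..<n}" by auto
      then show ?thesis using r by (simp add: q_def sum.If_cases Int_def)
    qed
    ultimately have "(\<Sum>i<n. g i) = n * \<delta> + h * (\<Sum>i<n. i div s) + ((n - 1) * e + r)"
      unfolding g_def by (simp add: sum.distrib sum_distrib_left)
    also have "(n - 1) * e + r = D" unfolding e_def r_def by (rule mult_div_mod_eq)
    finally show ?thesis using M unfolding D_def by simp
  qed
  moreover have "g (n - 1) \<le> \<delta> + h * ((n - 1) div s) + D div (n - 1) + 1"
    unfolding g_def p_def q_def e_def by simp
  ultimately show thesis using that by blast
qed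

lemma exists_graph_sp_le:
  fixes \<delta> k s n m :: nat
  defines "S \<equiv> n * \<delta> + (k + 1) * (\<Sum>i<n. i div s)"
  defines "a \<equiv> \<delta> + (k + 1) * ((n - 1) div s) + (2 * m - S) div (n - 1) + 1"
  assumes s: "s > 0" and n: "n \<ge> 2" and \<delta>: "\<delta> \<ge> 1" and S: "S \<le> 2 * m"
    and a: "(a + \<delta> + 1)\<^sup>2 \<le> 4 * \<delta> * n"
  shows "\<exists>E. simple_graph {..<n} E \<and> card E = m \<and> min_degree {..<n} E = \<delta> \<and> sp {..<n} E k \<le> s"
proof -
  obtain g where g: "g 0 = \<delta>" "mono g" "\<And>i. g i + (k + 1) \<le> g (i + s)"
    "(\<Sum>i<n. g i) = 2 * m" "g (n - 1) \<le> a"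
    using exists_spread_sequence[OF s n S[unfolded S_def]] unfolding a_def S_def by metis
  \<comment> \<open>Reversed because the realization theorem wants nonincreasing degrees; the vertex
    of degree \<delta> becomes \<open>n - 1\<close>.\<close>
  define c where "c i = g (n - 1 - i)" for i
  have lo: "\<delta> \<le> g i" for i using monoD[OF g(2), of 0 i] g(1) by simp
  have sum: "(\<Sum>i<n. c i) = 2 * m"
    using sum.nat_diff_reindex[of g n] g(4) unfolding c_def by simp
  have "\<exists>E. simple_graph {..<n} E \<and> (\<forall>i<n. degree E i = c i)"
  proof (rule graphic_if_bounded[OF _ _ _ \<delta> _ a])
    show "c j \<le> c i" if "i \<le> j" for i j
      unfolding c_def by (rule monoD[OF g(2)]) (use that in auto)
    show "c i \<le> a" for i
      unfolding c_def by (rule order_trans[OF monoD[OF g(2)] g(5)]) simp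
  qed (use sum lo in \<open>auto simp: c_def\<close>)
  then obtain E where G: "simple_graph {..<n} E" and deg: "\<And>i. i < n \<Longrightarrow> degree E i = c i" by blast
  have "card E = m" using sum_degree[OF G] deg sum by simp
  moreover have "min_degree {..<n} E = \<delta>" unfolding min_degree_def
  proof (rule Min_eqI)
    have "degree E (n - 1) = \<delta>" using deg[of "n - 1"] n g(1) unfolding c_def by simp
    then show "\<delta> \<in> degree E ` {..<n}" using n
      by (metis diff_less image_eqI lessThan_iff less_one less_le_trans zero_less_numeral)
    show "\<And>y. y \<in> degree E ` {..<n} \<Longrightarrow> \<delta> \<le> y" using deg lo unfolding c_def by auto
  qed simp
  moreover have "sp {..<n} E k \<le> s"
  proof (rule sp_le)
    fix B :: "nat set"
    assume B: "B \<subseteq> {..<n}" "B \<noteq> {}"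
      and close: "\<And>u v. u \<in> B \<Longrightarrow> v \<in> B \<Longrightarrow> degree E u \<le> degree E v + k"
    have fin: "finite B" using B(1) finite_subset by blast
    define i j where "i = Min B" and "j = Max B"
    have "i \<in> B" "j \<in> B" unfolding i_def j_def using fin B(2) by (rule Min_in, rule Max_in)
    moreover from this have "i \<le> j" unfolding j_def by (intro Max_ge fin)
    ultimately have ij: "i \<in> B" "j \<in> B" "i < n" "j < n" "i \<le> j" using B(1) by auto
    \<comment> \<open>More than \<open>s\<close> vertices force the extreme indices of
      \<open>B\<close> to be at least \<open>s\<close> apart, and then their degrees differ by at
      least \<open>k + 1\<close>.\<close>
    show "card B \<le> s"
    proof (rule ccontr)
      assume "\<not> card B \<le> s"
      moreover have "B \<subseteq> {i..j}" using fin unfolding i_def j_def by auto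
      then have "card B \<le> j + 1 - i" using card_mono[of "{i..j}" B] by simp
      ultimately have "n - 1 - j + s \<le> n - 1 - i" using ij by simp
      then have "c j + (k + 1) \<le> c i"
        using g(3)[of "n - 1 - j"] monoD[OF g(2), of "n - 1 - j + s" "n - 1 - i"]
        unfolding c_def by simp
      then show False using close[OF ij(1,2)] deg ij by simp
    qed
  qed (use n in \<open>auto simp: lessThan_empty_iff\<close>)
  ultimately show ?thesis using G by blast
qed

text \<open>To be read with N = n, M = 2m, T = \<open>n div s\<close> and S the sum of
  \<open>i div s\<close> over i < n. Then \<open>ge\<close> is \<open>f_T <= s\<close>, the
  assumption \<open>t\<close> is \<open>f_t > s - 1\<close>, and \<open>S\<close>, \<open>St\<close>
  are the level-set equality and inequality.\<close>

lemma arithmetic_bounds: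
  fixes N s T S \<delta> h x M t :: real
  assumes N: "N \<ge> (2 * x + 3)\<^sup>2" and x: "x \<ge> 0" and h: "h \<ge> 1" and s: "s > 0" and T: "T \<ge> 0"
    and M: "M = N * (\<delta> + h * x)"
    and S: "2 * S + s * T * (T + 1) = 2 * T * N" and sT: "s * T \<le> N" "N \<le> s * (T + 1)"
    and ge: "2 * (N * (\<delta> + T * h) - M) \<le> s * (h * T * (T + 1))"
    and t: "t \<ge> 1" "2 * (N * (\<delta> + t * h) - M) > (s - 1) * (h * t * (t + 1))"
    and St: "2 * t * N \<le> 2 * S + s * t * (t + 1)"
  shows "N * \<delta> + h * S \<le> M" "N \<le> s * (2 * x + 1)" "M - (N * \<delta> + h * S) < 2 * h * N"
proof -
  have "(2 * x + 3)\<^sup>2 > 0" using x by simp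
  then have N0: "N > 0" using N by linarith
  have hS: "h * (2 * S) + h * (s * T * (T + 1)) = h * (2 * T * N)"
    using arg_cong[OF S, of "\<lambda>z. h * z"] by (simp add: algebra_simps)
  then show base: "N * \<delta> + h * S \<le> M" using ge by (simp add: algebra_simps)
  then have "h * S \<le> h * (N * x)" unfolding M by (simp add: algebra_simps)
  then have SNx: "S \<le> N * x" using h by simp
  \<comment> \<open>N lies between consecutive multiples of s; expanding gives N^2 - sN <= 2sS, to
    be combined with S <= Nx.\<close>
  have "(N - s * T) * (s * (T + 1) - N) \<ge> 0" using sT by simp
  then have "N * N - s * N \<le> s * (2 * T * N - s * T * (T + 1))" by (simp add: algebra_simps)
  also have "2 * T * N - s * T * (T + 1) = 2 * S" using S by linarith
  also have "s * (2 * S) \<le> s * (2 * (N * x))" using SNx s by simp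
  finally have "N * N \<le> N * (s * (2 * x + 1))" by (simp add: algebra_simps)
  then show Ns: "N \<le> s * (2 * x + 1)" using N0 by simp
  have s3: "2 * x + 3 \<le> s"
  proof (rule ccontr)
    assume "\<not> ?thesis"
    then have "s * (2 * x + 1) \<le> (2 * x + 3) * (2 * x + 1)" using x by (intro mult_right_mono) auto
    also have "\<dots> < (2 * x + 3)\<^sup>2" using x by (simp add: power2_eq_square algebra_simps)
    finally show False using Ns N by simp
  qed
  have "s * (2 * x + 3) = s * (2 * x + 1) + 2 * s" by (simp add: algebra_simps)
  then have s1: "N \<le> (s - 1) * (2 * x + 3)" using Ns s3 x by (simp add: algebra_simps)
  have t2: "(s - 1) * (h * t * (t + 1)) < h * (2 * N * (t - x))"
    using t(2) unfolding M by (simp add: algebra_simps)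
  also have "\<dots> \<le> h * (2 * N * t)" using h N0 x by (intro mult_left_mono) auto
  finally have "(h * t) * ((s - 1) * (t + 1)) < (h * t) * (2 * N)" by (simp add: algebra_simps)
  then have "(s - 1) * (t + 1) < 2 * N" using h t(1) by (simp add: mult_less_cancel_left)
  then have "(2 * x + 3) * ((s - 1) * (t + 1)) < (2 * x + 3) * (2 * N)" using x by simp
  moreover have "N * (t + 1) \<le> ((s - 1) * (2 * x + 3)) * (t + 1)"
    using s1 t(1) by (intro mult_right_mono) auto
  ultimately have "N * (t + 1) < N * (2 * (2 * x + 3))" by (simp add: algebra_simps)
  then have "t + 1 \<le> 2 * (2 * x + 3)" using N0 by simp
  then have "(t + 1)\<^sup>2 \<le> (2 * (2 * x + 3))\<^sup>2" using t(1) by (intro power_mono) auto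
  then have "t * (t + 1) \<le> 4 * N"
    using N t(1) by (simp add: power2_eq_square algebra_simps)
  then have tN: "h * (t * (t + 1)) \<le> h * (4 * N)" using h by (intro mult_left_mono) auto
  \<comment> \<open>The bounds \<open>St\<close> with factor s and \<open>t2\<close> with factor s -
    1 differ by h*t*(t+1); this rounding loss exceeds twice the missing amount.\<close>
  have "h * (2 * t * N) \<le> h * (2 * S + s * t * (t + 1))" using St h by (intro mult_left_mono) auto
  then show "M - (N * \<delta> + h * S) < 2 * h * N"
    using t2 tN unfolding M by (simp add: algebra_simps)
qed

section \<open>The minimum\<close>

text \<open>Makes \<open>Max\<close> over infinitely many t meaningful: the values of
  \<open>f\<close> lie between -4m, as the denominator is at least 1, and n, as t + 1 >= 2.\<close>

lemma finite_ceiling_f: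
  assumes "real n * real \<delta> \<le> 2 * real m"
  shows "finite {\<lceil>f t n m \<delta> k\<rceil> | t. t \<ge> 1}"
proof (rule finite_subset)
  show "{\<lceil>f t n m \<delta> k\<rceil> | t. t \<ge> 1} \<subseteq> {- int (4 * m)..int n}"
  proof safe
    fix t :: nat assume t: "1 \<le> t"
    define q where "q = (real k + 1) * real t * (real t + 1)"
    have t': "real t \<ge> 1" using t by simp
    have kt: "(real k + 1) * real t \<ge> 1"
      using mult_mono[of 1 "real k + 1" 1 "real t"] t' by simp
    then have "(real k + 1) * real t * 2 \<le> q"
      unfolding q_def using t' by (intro mult_left_mono) auto
    then have q: "q \<ge> 2 * ((real k + 1) * real t)" "q \<ge> 1" using kt by auto
    have f: "f t n m \<delta> k * q = 2 * (real n * (real \<delta> + real t * (real k + 1)) - 2 * real m)"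
      unfolding f_def q_def[symmetric] using q by simp
    have "f t n m \<delta> k * q \<le> real n * (2 * ((real k + 1) * real t))"
      unfolding f using assms by (simp add: algebra_simps)
    also have "\<dots> \<le> real n * q" using q(1) by (rule mult_left_mono) simp
    finally have "f t n m \<delta> k \<le> real n" using q by simp
    moreover have "- (4 * real m) \<le> f t n m \<delta> k"
    proof (rule mult_right_le_imp_le)
      have "- (4 * real m) * q \<le> - (4 * real m) * 1"
        using q(2) by (intro mult_left_mono_neg) auto
      also have "\<dots> \<le> f t n m \<delta> k * q" unfolding f by simp
      finally show "- (4 * real m) * q \<le> f t n m \<delta> k * q" .
    qed (use q in simp)
    ultimately show "\<lceil>f t n m \<delta> k\<rceil> \<in> {- int (4 * m)..int n}"
      by (simp add: ceiling_le_iff le_ceiling_iff)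
  qed
qed simp

lemma exists_f_pos:
  assumes "n \<ge> 1"
  shows "\<exists>t\<ge>1. f t n m \<delta> k > 0"
proof (intro exI conjI)
  \<comment> \<open>Any t > 2m makes the numerator positive. Positivity of some \<open>f_t\<close>
    later gives \<open>s > 0\<close>, so that division by \<open>s\<close> makes sense.\<close>
  let ?t = "Suc (2 * m)"
  have "2 * real m < real ?t" by simp
  also have "\<dots> \<le> real n * (real ?t * (real k + 1))"
    using assms mult_mono[of 1 "real n" "real ?t" "real ?t * (real k + 1)"] by (simp add: algebra_simps)
  also have "\<dots> \<le> real n * (real \<delta> + real ?t * (real k + 1))"
    by (intro mult_left_mono) auto
  finally show "f ?t n m \<delta> k > 0" unfolding f_def by (intro divide_pos_pos mult_pos_pos) auto
qed simp

theorem theorem13: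
  fixes \<delta> k n m :: nat and h d x :: real
  assumes "\<delta> \<ge> 1" and "n \<ge> 1"
    and "h = real k + 1"
    and "d = 2 * real m / real n"
    and "d \<ge> real \<delta>"
    and "x = (d - real \<delta>) / h"
    and "real n \<ge> max ((2 * d + 5 * h + 1)\<^sup>2 / (4 * real \<delta>)) ((2 * x + 3)\<^sup>2)"
  shows "finite (sp_values n m \<delta> k) \<and> sp_values n m \<delta> k \<noteq> {} \<and>
    finite {\<lceil>f t n m \<delta> k\<rceil> | t. t \<ge> 1} \<and>
    Min (sp_values n m \<delta> k) = Max {\<lceil>f t n m \<delta> k\<rceil> | t. t \<ge> 1}"
proof -
  let ?F = "{\<lceil>f t n m \<delta> k\<rceil> | t. t \<ge> 1}"
  have h1: "h \<ge> 1" using assms(3) by simp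
  have x0: "x \<ge> 0" using assms(5,6) h1 by simp
  have hx: "h * x = d - real \<delta>" using assms(6) h1 by simp
  have dn: "2 * real m = real n * d" using assms(2,4) by simp
  have n\<delta>: "real n * real \<delta> \<le> 2 * real m" unfolding dn using assms(5) by (intro mult_left_mono) auto
  have nx: "(2 * x + 3)\<^sup>2 \<le> real n" using assms(7) by simp
  have "(2 * d + 5 * h + 1)\<^sup>2 / (4 * real \<delta>) \<le> real n" using assms(7) by simp
  then have nd: "(2 * d + 5 * h + 1)\<^sup>2 \<le> 4 * real \<delta> * real n"
    using assms(1) by (simp add: divide_le_eq mult.commute)
  have "(3::real)\<^sup>2 \<le> (2 * x + 3)\<^sup>2" using x0 by (intro power_mono) auto
  then have n9: "9 \<le> n" using nx by simp
  have finF: "finite ?F" using finite_ceiling_f[OF n\<delta>] .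
  have neF: "?F \<noteq> {}" by blast
  define s where "s = nat (Max ?F)"
  have pos: "Max ?F \<ge> 1"
  proof -
    obtain t where "t \<ge> 1" "f t n m \<delta> k > 0" using exists_f_pos[OF assms(2)] by blast
    then have "\<lceil>f t n m \<delta> k\<rceil> \<le> Max ?F" "\<lceil>f t n m \<delta> k\<rceil> \<ge> 1" using finF by (auto intro!: Max_ge)
    then show ?thesis by linarith
  qed
  then have s: "int s = Max ?F" "s > 0" unfolding s_def by auto
  have fs: "f t n m \<delta> k \<le> real s" if "t \<ge> 1" for t
  proof -
    have "\<lceil>f t n m \<delta> k\<rceil> \<le> Max ?F" using finF that by (auto intro!: Max_ge)
    then show ?thesis unfolding s(1)[symmetric] by (simp add: ceiling_le_iff)
  qed
  have "Max ?F \<in> ?F" using Max_in[OF finF neF] .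
  then obtain t where t: "t \<ge> 1" "\<lceil>f t n m \<delta> k\<rceil> = int s" unfolding s(1)[symmetric] by auto
  then have ft: "f t n m \<delta> k > real s - 1" by linarith

  define T where "T = n div s"
  define S where "S = (\<Sum>i<n. i div s)"
  have f_eq: "f t n m \<delta> k * (h * real t * (real t + 1)) = 2 * (real n * (real \<delta> + real t * h) - 2 * real m)"
    if "t \<ge> 1" for t
    unfolding f_def assms(3) using that by simp
  have S_eq: "2 * real S + real s * real T * (real T + 1) = 2 * real T * real n"
    using arg_cong[OF sum_div_eq[OF s(2), of n], of real] unfolding S_def T_def
    by (simp add: algebra_simps del: of_nat_sum)
  have S_ge: "2 * real t * real n \<le> 2 * real S + real s * real t * (real t + 1)"
  proof -
    have "2 * t * n \<le> 2 * S + s * t * (t + 1)"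
      using sum_ge_if_levels_small[of "{..<n}" "\<lambda>i. i div s" s t] card_div_level_le[OF s(2)]
      unfolding S_def by simp
    then have "real (2 * t * n) \<le> real (2 * S + s * t * (t + 1))" by (simp only: of_nat_le_iff)
    then show ?thesis by (simp add: algebra_simps)
  qed
  have "s * T \<le> n" "n \<le> s * (T + 1)"
    unfolding T_def using dividend_less_times_div[OF s(2), of n] by auto
  then have sT: "real s * real T \<le> real n" "real n \<le> real s * (real T + 1)"
    by (metis of_nat_mult of_nat_le_iff of_nat_add of_nat_1)+
  have M: "2 * real m = real n * (real \<delta> + h * x)" using dn hx by simp
  have T: "2 * (real n * (real \<delta> + real T * h) - 2 * real m) \<le> real s * (h * real T * (real T + 1))"
  \<comment> \<open>\<open>fs\<close> speaks only of indices at least 1; at \<open>T = 0\<close> the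
    claim is n\<delta> <= 2m, that is, d >= \<delta>.\<close>
  proof (cases "T = 0")
    case True
    then show ?thesis using n\<delta> by (simp add: mult.commute)
  next
    case False
    then have "T \<ge> 1" by simp
    from mult_right_mono[OF fs[OF this], of "h * real T * (real T + 1)"] show ?thesis
      unfolding f_eq[OF \<open>T \<ge> 1\<close>] using h1 by simp
  qed
  have t': "2 * (real n * (real \<delta> + real t * h) - 2 * real m) > (real s - 1) * (h * real t * (real t + 1))"
    unfolding f_eq[OF t(1), symmetric] using ft t(1) h1 by (intro mult_strict_right_mono) auto
  note bounds = arithmetic_bounds[OF nx x0 h1 _ _ M S_eq sT T _ t' S_ge]
  have b1: "real n * real \<delta> + h * real S \<le> 2 * real m"
    and b2: "real n \<le> real s * (2 * x + 1)"
    and b3: "2 * real m - (real n * real \<delta> + h * real S) < 2 * h * real n"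
    using bounds s(2) t(1) by auto
  define S' where "S' = n * \<delta> + (k + 1) * S"
  have S': "real S' = real n * real \<delta> + h * real S"
    unfolding S'_def assms(3) by (simp add: algebra_simps)
  have b1': "S' \<le> 2 * m" using b1 unfolding S'[symmetric] by linarith
  define a where "a = \<delta> + (k + 1) * ((n - 1) div s) + (2 * m - S') div (n - 1) + 1"
  have e: "(2 * m - S') div (n - 1) + 1 \<le> 3 * (k + 1)"
  proof -
    have "real (2 * m - S') < 2 * h * real n" using b3 b1' S' by simp
    also have "\<dots> = h * (2 * real n)" by simp
    \<comment> \<open>Only n - 1 vertices share the missing amount, and 2n <= 3(n-1) once n >= 3.
      The strict inequality leaves room for the extra 1 of the remainder.\<close>
    also have "\<dots> \<le> h * (3 * real (n - 1))" using h1 n9 by (intro mult_left_mono) auto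
    also have "\<dots> = real (3 * (k + 1) * (n - 1))" unfolding assms(3) by simp
    finally have "2 * m - S' < 3 * (k + 1) * (n - 1)" by (simp only: of_nat_less_iff)
    then have "(2 * m - S') div (n - 1) < 3 * (k + 1)" by (rule less_mult_imp_div_less)
    then show ?thesis by simp
  qed
  have "real ((n - 1) div s) \<le> 2 * x + 1"
  proof -
    have "s * ((n - 1) div s) \<le> n" by (rule order_trans[OF times_div_less_eq_dividend]) simp
    then have "real s * real ((n - 1) div s) \<le> real n" by (metis of_nat_mult of_nat_le_iff)
    then have "real s * real ((n - 1) div s) \<le> real s * (2 * x + 1)" using b2 by linarith
    then show ?thesis using s(2) by simp
  qed
  then have "h * real ((n - 1) div s) \<le> h * (2 * x + 1)" using h1 by (intro mult_left_mono) auto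
  moreover have "real ((2 * m - S') div (n - 1) + 1) \<le> 3 * h"
    using of_nat_mono[OF e, where 'a = real] unfolding assms(3) by simp
  moreover have "real a = real \<delta> + h * real ((n - 1) div s) + real ((2 * m - S') div (n - 1) + 1)"
    unfolding a_def assms(3) by (simp add: algebra_simps)
  \<comment> \<open>Since h*x = d - \<delta>, the steps contribute at most 2(d - \<delta>) + h and
    the increment at most 3h.\<close>
  ultimately have "real a + real \<delta> + 1 \<le> 2 * d + 5 * h + 1" using hx h1 by (simp add: algebra_simps)
  then have "(real a + real \<delta> + 1)\<^sup>2 \<le> (2 * d + 5 * h + 1)\<^sup>2" by (intro power_mono) auto
  then have "real ((a + \<delta> + 1)\<^sup>2) \<le> real (4 * \<delta> * n)" using nd by (simp add: ac_simps)
  then have "(a + \<delta> + 1)\<^sup>2 \<le> 4 * \<delta> * n" by (simp only: of_nat_le_iff)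
  then obtain E where E: "simple_graph {..<n} E" "card E = m" "min_degree {..<n} E = \<delta>" "sp {..<n} E k \<le> s"
    using exists_graph_sp_le[OF s(2) _ assms(1), of n k m] n9 b1'
    unfolding a_def S'_def S_def by auto

  have lower: "Max ?F \<le> v" if "v \<in> sp_values n m \<delta> k" for v
  proof -
    obtain V :: "nat set" and E where V: "v = int (sp V E k)" "simple_graph V E" "card V = n"
      "card E = m" "min_degree V E = \<delta>" using \<open>v \<in> _\<close> unfolding sp_values_def by blast
    have "\<lceil>f t n m \<delta> k\<rceil> \<le> v" if "t \<ge> 1" for t
      using f_le_sp[OF V(2,3) assms(2) V(4,5) that, of k] unfolding V(1) by (simp add: ceiling_le_iff)
    then show ?thesis using finF neF by (auto simp: Max_le_iff)
  qed
  have mem: "int (sp {..<n} E k) \<in> sp_values n m \<delta> k"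
    unfolding sp_values_def using E by (auto intro!: exI[of _ "{..<n}"] exI[of _ E])
  have finS: "finite (sp_values n m \<delta> k)"
  proof (rule finite_subset)
    show "sp_values n m \<delta> k \<subseteq> int ` {..n}"
    proof
      fix v assume "v \<in> sp_values n m \<delta> k"
      then obtain V :: "nat set" and E where V: "v = int (sp V E k)" "simple_graph V E" "card V = n"
        unfolding sp_values_def by blast
      have "finite V" using V(2) unfolding simple_graph_def by simp
      moreover have "V \<noteq> {}" using V(3) assms(2) by auto
      ultimately have "sp V E k \<le> n" using V(3) card_mono[of V] by (intro sp_le) auto
      then show "v \<in> int ` {..n}" using V(1) by simp
    qed
  qed simp
  have "int (sp {..<n} E k) = Max ?F" using lower[OF mem] E(4) s(1) by linarith
  then have "Min (sp_values n m \<delta> k) = Max ?F"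
    using finS mem lower by (intro Min_eqI) auto
  then show ?thesis using finS mem finF by blast
qed

end
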